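(* Let $n,d\ge1$ be integers. For $f:(\mathbb Z/n\mathbb Z)^d\to\mathbb C$ define $Rf:\mathrm{Hom}((\mathbb Z/n\mathbb Z)^d,\mathbb Z/n\mathbb Z)\times\mathbb Z/n\mathbb Z\to\mathbb C$ by $Rf(\psi,c)=\sum_{x:\,\psi(x)=c}f(x)$. Then for every $x\in(\mathbb Z/n\mathbb Z)^d$, $$f(x)=\frac{1}{n^{d-1}\varphi(n)}\sum_{\psi\in\mathrm{Hom}((\mathbb Z/n\mathbb Z)^d,\mathbb Z/n\mathbb Z)}Rf(\psi,\psi(x))\prod_{p\mid\psi}(1-p^{d-1}),$$ where $\varphi$ is Euler's totient function and the product runs over the primes $p$ dividing $n$ such that $\psi$ takes values in $p\mathbb Z/n\mathbb Z$ (i.e. $p$ divides every element of the image of $\psi$). *)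

theory Defs
  imports
    "HOL-Algebra.Product_Groups"
    "HOL-Number_Theory.Totient"
begin

text \<open>
  The group \<open>(\<int>/n\<int>)\<^sup>d\<close>. Its elements are the functions \<open>{..<d} \<rightarrow> {0..<n}\<close> that are
  \<open>undefined\<close> outside \<open>{..<d}\<close>.
\<close>

abbreviation Zn_power :: "nat \<Rightarrow> nat \<Rightarrow> (nat \<Rightarrow> int) monoid" where
  "Zn_power n d \<equiv> product_group {..<d} (\<lambda>_. integer_mod_group n)"

text \<open>
  The library's \<open>hom G H\<close> leaves values outside \<open>carrier G\<close> unconstrained, so one homomorphism has
  infinitely many representatives there. Intersecting with \<open>extensional (carrier G)\<close> keeps
  exactly one representative of each, so that sums over the set are sums over \<open>Hom(G, H)\<close>.
\<close>

definition Hom :: "nat \<Rightarrow> nat \<Rightarrow> ((nat \<Rightarrow> int) \<Rightarrow> int) set" where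
  "Hom n d = hom (Zn_power n d) (integer_mod_group n) \<inter> extensional (carrier (Zn_power n d))"

definition Radon ::
  "nat \<Rightarrow> nat \<Rightarrow> ((nat \<Rightarrow> int) \<Rightarrow> complex) \<Rightarrow> ((nat \<Rightarrow> int) \<Rightarrow> int) \<Rightarrow> int \<Rightarrow> complex" where
  "Radon n d f \<psi> c = (\<Sum>x\<in>{x \<in> carrier (Zn_power n d). \<psi> x = c}. f x)"

text \<open>
  The subgroup \<open>p\<int>/n\<int>\<close> of multiples of \<open>p\<close> in \<open>\<int>/n\<int>\<close>; \<open>integer_mod_group\<close> is written
  multiplicatively, so \<open>y [^] p\<close> is \<open>p \<sdot> y\<close>.
\<close>

definition multiples_mod :: "nat \<Rightarrow> nat \<Rightarrow> int set" where
  "multiples_mod p n = (\<lambda>y. y [^]\<^bsub>integer_mod_group n\<^esub> p) ` carrier (integer_mod_group n)"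

definition primes_dividing :: "nat \<Rightarrow> nat \<Rightarrow> ((nat \<Rightarrow> int) \<Rightarrow> int) \<Rightarrow> nat set" where
  "primes_dividing n d \<psi> =
     {p. prime p \<and> p dvd n \<and> \<psi> ` carrier (Zn_power n d) \<subseteq> multiples_mod p n}"

end

theory Submission
  imports Defs "HOL-Library.Real_Mod"
begin

text \<open>
  Homomorphisms are the maps \<open>x \<mapsto> a \<cdot> x\<close> for \<open>a \<in> (\<int>/n\<int>)\<^sup>d\<close>, so the coefficient of
  \<open>f y\<close> on the right-hand side is a sum of the weights \<open>\<Prod>\<^bsub>p | a\<^esub> (1 - p\<^sup>d\<^sup>-\<^sup>1)\<close> over all \<open>a\<close>
  with \<open>a \<cdot> z = 0\<close>, where \<open>z = y - x\<close>. Expanding the product gives terms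
  \<open>\<mu>(e) e\<^sup>d\<^sup>-\<^sup>1 #{a. e | a, a \<cdot> z = 0}\<close> for squarefree \<open>e | n\<close>. By orthogonality of characters
  \<open>e\<^sup>d\<^sup>-\<^sup>1 #{a. e | a, a \<cdot> z = 0} = n\<^sup>d\<^sup>-\<^sup>1 #{s \<in> \<int>/n\<int>. e | s, s z = 0}\<close>, and summing back over \<open>e\<close>
  leaves \<open>n\<^sup>d\<^sup>-\<^sup>1\<close> times the number of units \<open>s\<close> with \<open>s z = 0\<close>, which is \<open>\<phi>(n)\<close> if
  \<open>z = 0\<close> and \<open>0\<close> otherwise.
\<close>

section \<open>Counting solutions of linear congruences\<close>

text \<open>The summands are the powers of an \<open>m\<close>-th root of unity \<open>w\<close>, so
  the sum is geometric: it vanishes unless \<open>w = 1\<close>, which happens exactly when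
  \<open>m\<close> divides \<open>v\<close>.\<close>

lemma sum_cis_residues:
  fixes v :: int
  assumes "m > 0"
  shows "(\<Sum>k\<in>{0..<int m}. cis (2 * pi * of_int (k * v) / of_nat m)) = (if int m dvd v then of_nat m else 0)"
proof -
  define w where "w = cis (2 * pi * of_int v / of_nat m)"
  have w_eq_1: "w = 1 \<longleftrightarrow> int m dvd v"
  proof
    assume "w = 1"
    then obtain j :: int where "2 * pi * of_int v / of_nat m = of_int j * (2 * pi)"
      unfolding w_def cis_eq_1_iff by blast
    then have "real_of_int v = of_int (j * int m)"
      using assms by (simp add: field_simps)
    then have "v = j * int m"
      by (simp only: of_int_eq_iff)
    then show "int m dvd v"
      by simp
  next
    assume "int m dvd v"
    then show "w = 1"
      using assms unfolding w_def cis_eq_1_iff by (auto elim!: dvdE)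
  qed
  have "w ^ m = cis (2 * pi * of_int v)"
    using assms by (simp add: w_def DeMoivre)
  then have "w ^ m = 1"
    by simp
  have "(\<Sum>k\<in>{0..<int m}. cis (2 * pi * of_int (k * v) / of_nat m)) = (\<Sum>k<m. w ^ k)"
    by (rule sum.reindex_bij_witness [of _ int nat])
       (auto simp: w_def DeMoivre algebra_simps)
  also have "\<dots> = (if int m dvd v then of_nat m else 0)"
    using \<open>w ^ m = 1\<close> w_eq_1 by (auto simp: sum_gp_strict)
  finally show ?thesis .
qed

text \<open>Times \<open>m\<close>, both sides equal \<open>\<Sum>\<^sub>t \<Sum>\<^sub>b exp (2\<pi>i t (b \<cdot> z) / m)\<close>.\<close>

lemma card_orthogonal_residues:
  fixes z :: "nat \<Rightarrow> int"
  assumes "m > 0" and "d > 0"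
  shows "card {b \<in> {..<d} \<rightarrow>\<^sub>E {0..<int m}. int m dvd (\<Sum>i<d. b i * z i)} =
    m ^ (d - 1) * card {t \<in> {0..<int m}. \<forall>i<d. int m dvd t * z i}"
proof -
  let ?B = "{..<d} \<rightarrow>\<^sub>E {0..<int m}"
  let ?e = "\<lambda>v::int. cis (2 * pi * of_int v / of_nat m)"
  have fin: "finite ?B"
    by (intro finite_PiE) auto
  have e_sum: "?e (sum g A) = (\<Prod>i\<in>A. ?e (g i))" if "finite A" for g and A :: "nat set"
    using that by induction (simp_all add: add_divide_distrib ring_distribs flip: cis_mult)
  have "of_nat (m * card {b \<in> ?B. int m dvd (\<Sum>i<d. b i * z i)}) =
      (\<Sum>b\<in>?B. if int m dvd (\<Sum>i<d. b i * z i) then of_nat m else (0::complex))"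
    using fin by (simp add: sum.If_cases Int_def mult.commute)
  also have "\<dots> = (\<Sum>b\<in>?B. \<Sum>t\<in>{0..<int m}. ?e (t * (\<Sum>i<d. b i * z i)))"
    by (simp only: sum_cis_residues [OF \<open>m > 0\<close>])
  also have "\<dots> = (\<Sum>t\<in>{0..<int m}. \<Sum>b\<in>?B. ?e (t * (\<Sum>i<d. b i * z i)))"
    by (rule sum.swap)
  also have "\<dots> = (\<Sum>t\<in>{0..<int m}. \<Sum>b\<in>?B. \<Prod>i<d. ?e (b i * (t * z i)))"
    by (simp only: sum_distrib_left e_sum finite_lessThan mult.left_commute)
  \<comment> \<open>The summand is now a product of factors that depend on one coordinate
    \<open>b i\<close> each, so the sum over all vectors splits into \<open>d\<close> independent
    character sums.\<close>
  also have "\<dots> = (\<Sum>t\<in>{0..<int m}. \<Prod>i<d. \<Sum>k\<in>{0..<int m}. ?e (k * (t * z i)))"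
    by (intro sum.cong refl prod_sum_PiE [symmetric]) auto
  also have "\<dots> = (\<Sum>t\<in>{0..<int m}. \<Prod>i<d. if int m dvd t * z i then of_nat m else 0)"
    by (simp only: sum_cis_residues [OF \<open>m > 0\<close>])
  also have "\<dots> = (\<Sum>t\<in>{0..<int m}. if \<forall>i<d. int m dvd t * z i then of_nat m ^ d else 0)"
    by (intro sum.cong refl) (auto simp: prod_zero_iff)
  also have "\<dots> = of_nat (m ^ d * card {t \<in> {0..<int m}. \<forall>i<d. int m dvd t * z i})"
    by (simp add: sum.If_cases Int_def mult.commute)
  finally have "m * card {b \<in> ?B. int m dvd (\<Sum>i<d. b i * z i)} =
      m ^ d * card {t \<in> {0..<int m}. \<forall>i<d. int m dvd t * z i}"
    by (simp only: of_nat_eq_iff)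
  also have "m ^ d = m * m ^ (d - 1)"
    using \<open>d > 0\<close> by (simp add: power_eq_if)
  finally show ?thesis
    using \<open>m > 0\<close> by simp
qed

text \<open>Write \<open>n = e * m\<close>. Dividing \<open>a\<close> and \<open>s\<close> by
  \<open>e\<close> turns conditions modulo \<open>n\<close> into conditions modulo \<open>m\<close>,
  where \<open>card_orthogonal_residues\<close> applies; then
  \<open>e ^ (d - 1) * m ^ (d - 1)\<close> is \<open>n ^ (d - 1)\<close>.\<close>

lemma card_orthogonal_multiples:
  fixes z :: "nat \<Rightarrow> int"
  assumes "n > 0" and "d > 0" and "e dvd n"
  shows "e ^ (d - 1) * card {a \<in> {..<d} \<rightarrow>\<^sub>E {0..<int n}. (\<forall>i<d. int e dvd a i) \<and> int n dvd (\<Sum>i<d. a i * z i)} =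
    n ^ (d - 1) * card {s \<in> {0..<int n}. int e dvd s \<and> (\<forall>i<d. int n dvd s * z i)}"
proof -
  obtain m where n: "n = e * m"
    using \<open>e dvd n\<close> by (elim dvdE)
  have "e > 0" "m > 0"
    using \<open>n > 0\<close> by (auto simp: n)
  have range: "int e * k \<in> {0..<int n} \<longleftrightarrow> k \<in> {0..<int m}" for k
    using \<open>e > 0\<close> by (auto simp: n zero_le_mult_iff)
  have dvd: "int n dvd int e * k \<longleftrightarrow> int m dvd k" for k
    using \<open>e > 0\<close> by (simp add: n)
  have "bij_betw (\<lambda>b. \<lambda>i\<in>{..<d}. int e * b i)
      {b \<in> {..<d} \<rightarrow>\<^sub>E {0..<int m}. int m dvd (\<Sum>i<d. b i * z i)}
      {a \<in> {..<d} \<rightarrow>\<^sub>E {0..<int n}. (\<forall>i<d. int e dvd a i) \<and> int n dvd (\<Sum>i<d. a i * z i)}"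
  proof (rule bij_betw_byWitness [where f' = "\<lambda>a. \<lambda>i\<in>{..<d}. a i div int e"], goal_cases)
    case 1
    then show ?case
      using \<open>e > 0\<close> by (auto simp: fun_eq_iff PiE_iff extensional_def)
  next
    case 2
    then show ?case
      using \<open>e > 0\<close> by (auto simp: fun_eq_iff PiE_iff extensional_def)
  next
    case 3
    then show ?case
      using range by (auto simp: PiE_iff mult.assoc dvd simp flip: sum_distrib_left simp del: atLeastLessThan_iff)
  next
    case 4
    \<comment> \<open>The division is exact because \<open>e\<close> divides every
      \<open>a i\<close>, so \<open>e\<close> can be pulled out of the sum and cancelled against
      \<open>n\<close>.\<close>
    have "(\<lambda>i\<in>{..<d}. a i div int e) \<in> {..<d} \<rightarrow>\<^sub>E {0..<int m} \<and> int m dvd (\<Sum>i<d. (\<lambda>i\<in>{..<d}. a i div int e) i * z i)"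
      if a: "a \<in> {..<d} \<rightarrow>\<^sub>E {0..<int n}" "\<forall>i<d. int e dvd a i" "int n dvd (\<Sum>i<d. a i * z i)" for a
    proof -
      have a_eq: "a i = int e * (a i div int e)" if "i < d" for i
        using a(2) that by simp
      have "(\<Sum>i<d. a i * z i) = int e * (\<Sum>i<d. a i div int e * z i)"
        unfolding sum_distrib_left by (intro sum.cong refl) (use a(2) in auto)
      then have "int m dvd (\<Sum>i<d. a i div int e * z i)"
        using a(3) by (simp add: dvd)
      moreover have "a i div int e \<in> {0..<int m}" if "i < d" for i
        using a(1) a_eq [OF that] range [of "a i div int e"] that by (auto simp: PiE_iff)
      ultimately show ?thesis
        by (auto simp: PiE_iff)
    qed
    then show ?case
      by blast
  qed
  then have card_a: "card {a \<in> {..<d} \<rightarrow>\<^sub>E {0..<int n}. (\<forall>i<d. int e dvd a i) \<and> int n dvd (\<Sum>i<d. a i * z i)} =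
      card {b \<in> {..<d} \<rightarrow>\<^sub>E {0..<int m}. int m dvd (\<Sum>i<d. b i * z i)}"
    by (simp add: bij_betw_same_card)
  have "bij_betw ((*) (int e)) {t \<in> {0..<int m}. \<forall>i<d. int m dvd t * z i}
      {s \<in> {0..<int n}. int e dvd s \<and> (\<forall>i<d. int n dvd s * z i)}"
    by (rule bij_betw_byWitness [where f' = "\<lambda>s. s div int e"])
       (use \<open>e > 0\<close> range in \<open>auto simp: mult.assoc dvd simp del: atLeastLessThan_iff elim!: dvdE\<close>)
  then have card_s: "card {s \<in> {0..<int n}. int e dvd s \<and> (\<forall>i<d. int n dvd s * z i)} =
      card {t \<in> {0..<int m}. \<forall>i<d. int m dvd t * z i}"
    by (simp add: bij_betw_same_card)
  show ?thesis
    unfolding card_a card_s card_orthogonal_residues [OF \<open>m > 0\<close> \<open>d > 0\<close>]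
    by (simp add: n power_mult_distrib)
qed

section \<open>The weighted count\<close>

text \<open>A new prime is coprime to the product of the others. This replaces a condition on a set
  of primes by divisibility by one squarefree number.\<close>

lemma prod_primes_dvd_iff:
  assumes "finite S" and "\<And>p. p \<in> S \<Longrightarrow> prime p"
  shows "int (\<Prod>S) dvd a \<longleftrightarrow> (\<forall>p\<in>S. int p dvd a)"
  using assms
proof (induction S)
  case empty
  then show ?case by simp
next
  case (insert p S)
  have "coprime p (\<Prod>S)"
    using insert by (intro prod_coprime_right primes_coprime) auto
  then have "coprime (int p) (int (\<Prod>S))"
    by (simp only: coprime_int_iff)
  then have "int p * int (\<Prod>S) dvd a \<longleftrightarrow> int p dvd a \<and> int (\<Prod>S) dvd a"
    by (meson divides_mult dvd_mult_left dvd_mult_right)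
  then show ?case
    using insert by simp
qed

text \<open>The product expands over the subsets of the filtered set. Putting \<open>Q\<close> into
  an indicator keeps the range \<open>Pow P\<close> independent of \<open>Q\<close>, so that this
  sum can be swapped with an outer sum over a variable on which \<open>Q\<close> depends.\<close>

lemma prod_diff_filter:
  fixes g :: "'a \<Rightarrow> 'b :: comm_ring_1"
  assumes "finite P"
  shows "(\<Prod>p\<in>{p \<in> P. Q p}. 1 - g p) = (\<Sum>S\<in>Pow P. if \<forall>p\<in>S. Q p then (-1) ^ card S * prod g S else 0)"
proof -
  have "(\<Prod>p\<in>{p \<in> P. Q p}. 1 - g p) = (\<Sum>S\<in>Pow {p \<in> P. Q p}. (-1) ^ card S * prod g S)"
    using assms by (subst prod_diff_conv_sum) simp_all
  also have "Pow {p \<in> P. Q p} = {S \<in> Pow P. \<forall>p\<in>S. Q p}"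
    by auto
  finally show ?thesis
    using assms by (simp only: sum.inter_filter finite_Pow_iff)
qed

lemma coprime_iff_no_common_prime_factor:
  assumes "n > 0"
  shows "coprime s (int n) \<longleftrightarrow> (\<forall>p\<in>prime_factors n. \<not> int p dvd s)"
proof
  assume "coprime s (int n)"
  then show "\<forall>p\<in>prime_factors n. \<not> int p dvd s"
    by (metis coprime_common_divisor in_prime_factors_iff not_prime_unit of_nat_dvd_iff prime_nat_int_transfer)
next
  assume *: "\<forall>p\<in>prime_factors n. \<not> int p dvd s"
  show "coprime s (int n)"
  proof (rule ccontr)
    assume "\<not> coprime s (int n)"
    then have "gcd (nat \<bar>s\<bar>) n \<noteq> 1"
      by (metis coprime_iff_gcd_eq_1 coprime_nat_abs_left_iff)
    then obtain p where "prime p" "p dvd gcd (nat \<bar>s\<bar>) n"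
      using prime_factor_nat by blast
    then have "int p dvd s" "p \<in> prime_factors n"
      using \<open>n > 0\<close> by (auto simp: in_prime_factors_iff int_dvd_int_iff [symmetric] simp del: int_dvd_int_iff)
    then show False
      using * by blast
  qed
qed

text \<open>\<open>totatives n\<close> lies in \<open>{1..n}\<close> and the residues in
  \<open>{0..<n}\<close>. The sets of coprime elements agree except for \<open>n = 1\<close>, where
  the residue is 0 and the totative is 1.\<close>

lemma card_coprime_residues:
  assumes "n > 0"
  shows "card {s \<in> {0..<int n}. coprime s (int n)} = totient n"
proof (cases "n = 1")
  case True
  have "{s \<in> {0..<int n}. coprime s (int n)} = {0}"
    by (auto simp: True)
  then show ?thesis
    by (simp add: True)
next
  case False
  have "s \<in> int ` totatives n" if s: "s \<in> {0..<int n}" "coprime s (int n)" for s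
  proof -
    obtain k where k: "s = int k"
      using s by (auto elim: nonneg_int_cases)
    then have "k \<noteq> 0"
      using s False by (auto intro: ccontr)
    then show ?thesis
      using s k by (auto simp: in_totatives_iff)
  qed
  moreover have "int k \<in> {0..<int n}" "coprime (int k) (int n)" if "k \<in> totatives n" for k
    using that totatives_less [OF that] assms False by (auto simp: in_totatives_iff)
  ultimately have "{s \<in> {0..<int n}. coprime s (int n)} = int ` totatives n"
    by blast
  then show ?thesis
    by (simp add: totient_def card_image)
qed

text \<open>For \<open>z = y - x\<close> this is the coefficient of \<open>f y\<close> in the
  inversion formula. \<open>prod_diff_filter\<close> is used twice: forwards with
  \<open>g p = p ^ (d - 1)\<close> on vectors \<open>a\<close>, then backwards with
  \<open>g p = 1\<close> on scalars \<open>s\<close>.\<close>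

lemma sum_weights_orthogonal:
  fixes z :: "nat \<Rightarrow> int"
  assumes "n > 0" and "d > 0"
  shows "(\<Sum>a\<in>{a \<in> {..<d} \<rightarrow>\<^sub>E {0..<int n}. int n dvd (\<Sum>i<d. a i * z i)}.
      \<Prod>p\<in>{p \<in> prime_factors n. \<forall>i<d. int p dvd a i}. 1 - of_nat p ^ (d - 1)) =
    (if \<forall>i<d. int n dvd z i then of_nat n ^ (d - 1) * of_nat (totient n) else (0 :: complex))"
proof -
  let ?P = "prime_factors n"
  let ?A = "{a \<in> {..<d} \<rightarrow>\<^sub>E {0..<int n}. int n dvd (\<Sum>i<d. a i * z i)}"
  let ?T = "{s \<in> {0..<int n}. \<forall>i<d. int n dvd s * z i}"
  have "finite ({..<d} \<rightarrow>\<^sub>E {0..<int n})"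
    by (intro finite_PiE) auto
  then have fin: "finite ?A" "finite ?T"
    by (auto intro: finite_subset [of _ "{0..<int n}"])
  \<comment> \<open>The weight of \<open>S\<close> is \<open>e ^ (d - 1)\<close> for
    \<open>e\<close> the product of \<open>S\<close>, exactly the factor that
    \<open>card_orthogonal_multiples\<close> trades for \<open>n ^ (d - 1)\<close>.\<close>
  have summand: "(\<Sum>a\<in>?A. if \<forall>p\<in>S. \<forall>i<d. int p dvd a i then (\<Prod>p\<in>S. of_nat p ^ (d - 1)) else 0) =
      of_nat n ^ (d - 1) * (\<Sum>s\<in>?T. if \<forall>p\<in>S. int p dvd s then 1 else (0 :: complex))"
    if "S \<subseteq> ?P" for S
  proof -
    have "finite S"
      using that finite_subset by auto
    then have S_dvd: "int (\<Prod>S) dvd a \<longleftrightarrow> (\<forall>p\<in>S. int p dvd a)" for a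
      using that by (intro prod_primes_dvd_iff) auto
    have "int (\<Prod>S) dvd int n"
      unfolding S_dvd using that by (auto simp: in_prime_factors_iff)
    then have "\<Prod>S dvd n"
      by (simp only: int_dvd_int_iff)
    have "(\<Sum>a\<in>?A. if \<forall>p\<in>S. \<forall>i<d. int p dvd a i then (\<Prod>p\<in>S. of_nat p ^ (d - 1)) else 0) =
      (\<Sum>a\<in>{a \<in> ?A. \<forall>i<d. int (\<Prod>S) dvd a i}. of_nat (\<Prod>S) ^ (d - 1) :: complex)"
      unfolding S_dvd sum.inter_filter [OF fin(1)]
      by (intro sum.cong refl) (auto simp: prod_power_distrib)
    also have "{a \<in> ?A. \<forall>i<d. int (\<Prod>S) dvd a i} =
      {a \<in> {..<d} \<rightarrow>\<^sub>E {0..<int n}. (\<forall>i<d. int (\<Prod>S) dvd a i) \<and> int n dvd (\<Sum>i<d. a i * z i)}"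
      by blast
    also have "(\<Sum>a\<in>\<dots>. of_nat (\<Prod>S) ^ (d - 1) :: complex) = of_nat (\<Prod>S ^ (d - 1) * card \<dots>)"
      by simp
    also have "\<dots> = of_nat (n ^ (d - 1) * card {s \<in> {0..<int n}. int (\<Prod>S) dvd s \<and> (\<forall>i<d. int n dvd s * z i)})"
      unfolding card_orthogonal_multiples [OF assms \<open>\<Prod>S dvd n\<close>] ..
    also have "{s \<in> {0..<int n}. int (\<Prod>S) dvd s \<and> (\<forall>i<d. int n dvd s * z i)} = {s \<in> ?T. \<forall>p\<in>S. int p dvd s}"
      unfolding S_dvd by blast
    also have "of_nat (n ^ (d - 1) * card \<dots>) = of_nat n ^ (d - 1) * (\<Sum>s\<in>\<dots>. 1 :: complex)"
      by simp
    finally show ?thesis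
      unfolding sum.inter_filter [OF fin(2)] .
  qed
  have "(\<Sum>a\<in>?A. \<Prod>p\<in>{p \<in> ?P. \<forall>i<d. int p dvd a i}. 1 - of_nat p ^ (d - 1)) =
    (\<Sum>a\<in>?A. \<Sum>S\<in>Pow ?P. if \<forall>p\<in>S. \<forall>i<d. int p dvd a i then (-1) ^ card S * (\<Prod>p\<in>S. of_nat p ^ (d - 1)) else (0 :: complex))"
    by (simp only: prod_diff_filter finite_set_mset)
  also have "\<dots> = (\<Sum>S\<in>Pow ?P. (-1) ^ card S *
      (\<Sum>a\<in>?A. if \<forall>p\<in>S. \<forall>i<d. int p dvd a i then (\<Prod>p\<in>S. of_nat p ^ (d - 1)) else 0))"
    unfolding sum_distrib_left by (subst sum.swap) (intro sum.cong refl, auto)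
  also have "\<dots> = (\<Sum>S\<in>Pow ?P. (-1) ^ card S *
      (of_nat n ^ (d - 1) * (\<Sum>s\<in>?T. if \<forall>p\<in>S. int p dvd s then 1 else 0)))"
    by (intro sum.cong refl) (subst summand, auto)
  also have "\<dots> = of_nat n ^ (d - 1) *
      (\<Sum>s\<in>?T. \<Sum>S\<in>Pow ?P. if \<forall>p\<in>S. int p dvd s then (-1) ^ card S * (\<Prod>p\<in>S. 1) else 0)"
    unfolding sum_distrib_left by (subst sum.swap) (intro sum.cong refl, auto)
  also have "\<dots> = of_nat n ^ (d - 1) * (\<Sum>s\<in>?T. \<Prod>p\<in>{p \<in> ?P. int p dvd s}. 1 - 1)"
    by (simp only: prod_diff_filter finite_set_mset)
  \<comment> \<open>A product of zeros is 1 only when it is empty, that is, when no prime factor of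
    \<open>n\<close> divides \<open>s\<close>.\<close>
  also have "\<dots> = of_nat n ^ (d - 1) * (\<Sum>s\<in>?T. if coprime s (int n) then 1 else 0)"
    unfolding coprime_iff_no_common_prime_factor [OF \<open>n > 0\<close>]
    by (intro arg_cong2 [of _ _ _ _ "(*)"] sum.cong refl) (auto simp: power_0_left)
  also have "\<dots> = of_nat n ^ (d - 1) * of_nat (card {s \<in> ?T. coprime s (int n)})"
    using fin by (simp flip: sum.inter_filter)
  \<comment> \<open>A unit \<open>s\<close> cancels from \<open>n dvd s * z i\<close>, which leaves
    a condition on \<open>z\<close> alone.\<close>
  also have "{s \<in> ?T. coprime s (int n)} =
      (if \<forall>i<d. int n dvd z i then {s \<in> {0..<int n}. coprime s (int n)} else {})"
    by (auto simp: coprime_commute coprime_dvd_mult_right_iff)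
  also have "card \<dots> = (if \<forall>i<d. int n dvd z i then totient n else 0)"
    by (simp only: if_distrib [of card] card_coprime_residues [OF \<open>n > 0\<close>] card.empty)
  finally show ?thesis
    by (simp only: if_distrib [of of_nat] if_distrib [of "(*) _"] of_nat_0 mult_zero_right)
qed

section \<open>Homomorphisms as coefficient vectors\<close>

lemma carrier_Zn_power: "n > 0 \<Longrightarrow> carrier (Zn_power n d) = {..<d} \<rightarrow>\<^sub>E {0..<int n}"
  by (simp add: carrier_integer_mod_group)

text \<open>The restriction to the carrier makes the map extensional, as membership in
  \<open>Hom\<close> requires.\<close>

definition dot_hom :: "nat \<Rightarrow> nat \<Rightarrow> (nat \<Rightarrow> int) \<Rightarrow> (nat \<Rightarrow> int) \<Rightarrow> int" where
  "dot_hom n d a = (\<lambda>x\<in>carrier (Zn_power n d). (\<Sum>i<d. a i * x i) mod int n)"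

text \<open>The entry is \<open>1 mod int n\<close> because for \<open>n = 1\<close> the only
  residue is 0.\<close>

definition unit_vec :: "nat \<Rightarrow> nat \<Rightarrow> nat \<Rightarrow> nat \<Rightarrow> int" where
  "unit_vec n d i = (\<lambda>j\<in>{..<d}. if j = i then 1 mod int n else 0)"

lemma unit_vec_carrier: "n > 0 \<Longrightarrow> unit_vec n d i \<in> carrier (Zn_power n d)"
  unfolding carrier_Zn_power by (auto simp: unit_vec_def)

lemma dot_hom_in_Hom:
  assumes "n > 0"
  shows "dot_hom n d a \<in> Hom n d"
proof -
  have "dot_hom n d a (x \<otimes>\<^bsub>Zn_power n d\<^esub> y) = dot_hom n d a x \<otimes>\<^bsub>integer_mod_group n\<^esub> dot_hom n d a y"
    if "x \<in> carrier (Zn_power n d)" "y \<in> carrier (Zn_power n d)" for x y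
  proof -
    have "x \<otimes>\<^bsub>Zn_power n d\<^esub> y \<in> carrier (Zn_power n d)"
      using that by (intro monoid.m_closed group.is_monoid product_group) auto
    then have "dot_hom n d a (x \<otimes>\<^bsub>Zn_power n d\<^esub> y) = (\<Sum>i<d. a i * ((x i + y i) mod int n)) mod int n"
      by (simp add: dot_hom_def)
    also have "\<dots> = (\<Sum>i<d. a i * (x i + y i)) mod int n"
      by (subst (1 2) mod_sum_eq [symmetric]) (simp add: mod_mult_right_eq)
    also have "\<dots> = ((\<Sum>i<d. a i * x i) + (\<Sum>i<d. a i * y i)) mod int n"
      by (simp add: ring_distribs sum.distrib)
    finally show ?thesis
      using that by (simp add: dot_hom_def mod_add_eq)
  qed
  moreover have "dot_hom n d a x \<in> carrier (integer_mod_group n)" if "x \<in> carrier (Zn_power n d)" for x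
    using that assms unfolding dot_hom_def by (simp add: carrier_integer_mod_group)
  ultimately show ?thesis
    by (auto simp: Hom_def hom_def dot_hom_def)
qed

lemma dot_hom_unit_vec:
  assumes "n > 0" and "i < d" and "a i \<in> {0..<int n}"
  shows "dot_hom n d a (unit_vec n d i) = a i"
proof -
  have "(\<Sum>j<d. a j * unit_vec n d i j) = a i * (1 mod int n)"
    using assms by (subst sum.remove [of _ i]) (simp_all add: unit_vec_def)
  then show ?thesis
    using assms unit_vec_carrier [of n d i] by (simp add: dot_hom_def mod_mult_right_eq)
qed

text \<open>The unit vectors generate the group, so their images determine the homomorphism. The
  proof builds \<open>x\<close> up one coordinate at a time.\<close>

lemma Hom_eq_dot_hom:
  assumes "n > 0" and "\<psi> \<in> Hom n d"
  shows "\<psi> = dot_hom n d (\<lambda>i\<in>{..<d}. \<psi> (unit_vec n d i))"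
proof
  fix x
  show "\<psi> x = dot_hom n d (\<lambda>i\<in>{..<d}. \<psi> (unit_vec n d i)) x"
  proof (cases "x \<in> carrier (Zn_power n d)")
    case False
    then show ?thesis
      using assms by (simp add: Hom_def dot_hom_def extensional_def)
  next
    case x: True
    let ?G = "Zn_power n d" and ?H = "integer_mod_group n"
    interpret group_hom ?G ?H \<psi>
      using assms by (simp add: group_hom_def group_hom_axioms_def Hom_def)
    define trunc where "trunc k = (\<lambda>j\<in>{..<d}. if j < k then x j else 0)" for k
    have trunc_carrier: "trunc k \<in> carrier ?G" for k
      using x \<open>n > 0\<close> unfolding carrier_Zn_power [OF \<open>n > 0\<close>] by (auto simp: trunc_def PiE_iff)
    have pow_unit_vec: "unit_vec n d i [^]\<^bsub>?G\<^esub> k = (\<lambda>j\<in>{..<d}. if j = i then int k mod int n else 0)" for i and k :: nat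
      by (induction k) (auto simp: fun_eq_iff unit_vec_def mod_simps add.commute)
    have trunc_eq: "\<psi> (trunc k) = (\<Sum>i<k. \<psi> (unit_vec n d i) * x i) mod int n" if "k \<le> d" for k
      using that
    proof (induction k)
      case 0
      have "trunc 0 = \<one>\<^bsub>?G\<^esub>"
        by (simp add: trunc_def)
      then show ?case
        by (simp only: hom_one) simp
    next
      case (Suc k)
      have xk: "x k \<in> {0..<int n}" "\<And>j. j < d \<Longrightarrow> x j mod int n = x j"
        using x Suc.prems unfolding carrier_Zn_power [OF \<open>n > 0\<close>] by (auto simp: PiE_iff)
      \<comment> \<open>In additive terms, \<open>x k\<close> times the \<open>k\<close>-th unit
        vector is added. The exponent \<open>nat (x k)\<close> loses nothing, since
        \<open>x k\<close> is a nonnegative representative.\<close>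
      have "trunc (Suc k) = trunc k \<otimes>\<^bsub>?G\<^esub> unit_vec n d k [^]\<^bsub>?G\<^esub> nat (x k)"
        using xk Suc.prems unfolding pow_unit_vec by (auto simp: fun_eq_iff trunc_def less_Suc_eq)
      then have "\<psi> (trunc (Suc k)) = \<psi> (trunc k) \<otimes>\<^bsub>?H\<^esub> \<psi> (unit_vec n d k) [^]\<^bsub>?H\<^esub> nat (x k)"
        using trunc_carrier unit_vec_carrier [OF \<open>n > 0\<close>] by (simp only: hom_mult hom_nat_pow G.nat_pow_closed)
      also have "\<dots> = (\<Sum>i<Suc k. \<psi> (unit_vec n d i) * x i) mod int n"
        using Suc xk(1) by (simp add: mod_simps mult.commute)
      finally show ?case .
    qed
    have "trunc d = x"
      using x by (auto simp: trunc_def fun_eq_iff PiE_iff extensional_def)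
    then show ?thesis
      using x trunc_eq [of d] by (simp add: dot_hom_def)
  qed
qed

text \<open>Evaluation at the unit vectors is the inverse map. The bijection turns sums over
  \<open>Hom n d\<close> into sums over coefficient vectors.\<close>

lemma bij_betw_dot_hom:
  assumes "n > 0"
  shows "bij_betw (dot_hom n d) ({..<d} \<rightarrow>\<^sub>E {0..<int n}) (Hom n d)"
proof (rule bij_betw_byWitness [where f' = "\<lambda>\<psi>. \<lambda>i\<in>{..<d}. \<psi> (unit_vec n d i)"])
  show "\<forall>a\<in>{..<d} \<rightarrow>\<^sub>E {0..<int n}. (\<lambda>i\<in>{..<d}. dot_hom n d a (unit_vec n d i)) = a"
    using dot_hom_unit_vec [OF assms] by (auto simp: fun_eq_iff PiE_iff extensional_def)
  show "\<forall>\<psi>\<in>Hom n d. dot_hom n d (\<lambda>i\<in>{..<d}. \<psi> (unit_vec n d i)) = \<psi>"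
    using Hom_eq_dot_hom [OF assms] by simp
  show "dot_hom n d ` ({..<d} \<rightarrow>\<^sub>E {0..<int n}) \<subseteq> Hom n d"
    using dot_hom_in_Hom [OF assms] by blast
  have "\<psi> (unit_vec n d i) \<in> {0..<int n}" if "\<psi> \<in> Hom n d" for \<psi> i
    using that hom_in_carrier [of \<psi> "Zn_power n d" "integer_mod_group n"] unit_vec_carrier [OF assms, of d i] assms
    by (simp add: Hom_def carrier_integer_mod_group hom_def Pi_iff)
  then show "(\<lambda>\<psi>. \<lambda>i\<in>{..<d}. \<psi> (unit_vec n d i)) ` Hom n d \<subseteq> {..<d} \<rightarrow>\<^sub>E {0..<int n}"
    by (simp add: image_subset_iff restrict_PiE_iff)
qed

text \<open>Since \<open>p\<close> divides \<open>n\<close>, reduction modulo \<open>n\<close>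
  preserves divisibility by \<open>p\<close>. Conversely, the quotient of a residue by
  \<open>p\<close> is again a residue.\<close>

lemma multiples_mod_iff:
  assumes "n > 0" and "p dvd n"
  shows "y \<in> multiples_mod p n \<longleftrightarrow> y \<in> {0..<int n} \<and> int p dvd y"
proof
  assume "y \<in> multiples_mod p n"
  then show "y \<in> {0..<int n} \<and> int p dvd y"
    using assms by (auto simp: multiples_mod_def dvd_mod_iff)
next
  assume y: "y \<in> {0..<int n} \<and> int p dvd y"
  then obtain k where k: "y = int p * k"
    by blast
  have "p > 0"
    using assms by (auto intro: Nat.gr0I)
  then have "0 \<le> k" "k \<le> y"
    using y by (auto simp: k zero_le_mult_iff mult_le_cancel_right1)
  then have "k \<in> carrier (integer_mod_group n)"
    using y assms by (simp add: carrier_integer_mod_group)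
  then show "y \<in> multiples_mod p n"
    using y unfolding multiples_mod_def by (auto simp: k image_iff intro!: bexI [of _ k])
qed

text \<open>Each \<open>a i\<close> is itself a value of the homomorphism, at a unit vector, and
  every value is an integer combination of the \<open>a i\<close> modulo \<open>n\<close>.\<close>

lemma primes_dividing_dot_hom:
  assumes "n > 0" and "a \<in> {..<d} \<rightarrow>\<^sub>E {0..<int n}"
  shows "primes_dividing n d (dot_hom n d a) = {p \<in> prime_factors n. \<forall>i<d. int p dvd a i}"
proof -
  have "dot_hom n d a ` carrier (Zn_power n d) \<subseteq> multiples_mod p n \<longleftrightarrow> (\<forall>i<d. int p dvd a i)"
    if "p dvd n" for p
  proof
    assume *: "dot_hom n d a ` carrier (Zn_power n d) \<subseteq> multiples_mod p n"
    show "\<forall>i<d. int p dvd a i"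
    proof (intro allI impI)
      fix i assume "i < d"
      then have "a i \<in> {0..<int n}"
        using assms by (auto simp: PiE_iff)
      then have "a i \<in> dot_hom n d a ` carrier (Zn_power n d)"
        using dot_hom_unit_vec [OF \<open>n > 0\<close> \<open>i < d\<close>] unit_vec_carrier [OF \<open>n > 0\<close>] by (metis imageI)
      then show "int p dvd a i"
        using * multiples_mod_iff [OF \<open>n > 0\<close> that] by blast
    qed
  next
    assume "\<forall>i<d. int p dvd a i"
    then have "int p dvd (\<Sum>i<d. a i * x i) mod int n" for x
      using that by (subst dvd_mod_iff) (auto intro!: dvd_sum)
    then show "dot_hom n d a ` carrier (Zn_power n d) \<subseteq> multiples_mod p n"
      using \<open>n > 0\<close> by (auto simp: dot_hom_def multiples_mod_iff [OF \<open>n > 0\<close> that] simp del: carrier_product_group)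
  qed
  then show ?thesis
    using \<open>n > 0\<close> by (auto simp: primes_dividing_def in_prime_factors_iff simp del: carrier_product_group)
qed

section \<open>The inversion formula\<close>

theorem theorem1p5:
  fixes n d :: nat
    and f :: "(nat \<Rightarrow> int) \<Rightarrow> complex"
    and x :: "nat \<Rightarrow> int"
  assumes "n \<ge> 1" and "d \<ge> 1"
    and "x \<in> carrier (Zn_power n d)"
  shows "f x = 1 / (of_nat n ^ (d - 1) * of_nat (totient n)) *
    (\<Sum>\<psi>\<in>Hom n d. Radon n d f \<psi> (\<psi> x) *
       (\<Prod>p\<in>primes_dividing n d \<psi>. 1 - of_nat p ^ (d - 1)))"
proof -
  have n: "n > 0" and d: "d > 0"
    using assms by auto
  let ?B = "{..<d} \<rightarrow>\<^sub>E {0..<int n}"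
  let ?w = "\<lambda>a :: nat \<Rightarrow> int. \<Prod>p\<in>{p \<in> prime_factors n. \<forall>i<d. int p dvd a i}. 1 - of_nat p ^ (d - 1) :: complex"
  have fin: "finite ?B"
    by (intro finite_PiE) auto
  have x: "x \<in> ?B"
    using assms(3) unfolding carrier_Zn_power [OF n] .
  have dot_eq: "dot_hom n d a y = dot_hom n d a x \<longleftrightarrow> int n dvd (\<Sum>i<d. a i * (y i - x i))"
    if "y \<in> ?B" for a y
    using that x unfolding dot_hom_def carrier_Zn_power [OF n]
    by (simp add: mod_eq_dvd_iff right_diff_distrib sum_subtractf)
  have y_eq: "(\<forall>i<d. int n dvd y i - x i) \<longleftrightarrow> y = x" if "y \<in> ?B" for y
  proof
    assume *: "\<forall>i<d. int n dvd y i - x i"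
    show "y = x"
    proof (rule PiE_ext [OF that x])
      fix i assume i: "i \<in> {..<d}"
      then have "y i mod int n = x i mod int n"
        using * by (simp add: mod_eq_dvd_iff)
      moreover have "y i \<in> {0..<int n}" "x i \<in> {0..<int n}"
        using PiE_mem [OF that i] PiE_mem [OF x i] .
      ultimately show "y i = x i"
        by simp
    qed
  qed simp
  have "(\<Sum>\<psi>\<in>Hom n d. Radon n d f \<psi> (\<psi> x) * (\<Prod>p\<in>primes_dividing n d \<psi>. 1 - of_nat p ^ (d - 1))) =
    (\<Sum>a\<in>?B. Radon n d f (dot_hom n d a) (dot_hom n d a x) * ?w a)"
    unfolding sum.reindex_bij_betw [OF bij_betw_dot_hom [OF n], symmetric]
    by (intro sum.cong refl) (simp only: primes_dividing_dot_hom [OF n])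
  also have "\<dots> = (\<Sum>a\<in>?B. \<Sum>y\<in>?B. f y * (if int n dvd (\<Sum>i<d. a i * (y i - x i)) then ?w a else 0))"
    unfolding Radon_def carrier_Zn_power [OF n] sum.inter_filter [OF fin] sum_distrib_right
    by (intro sum.cong refl) (auto simp: dot_eq)
  \<comment> \<open>Swapping the sums collects the coefficient of each \<open>f y\<close>.\<close>
  also have "\<dots> = (\<Sum>y\<in>?B. f y * (\<Sum>a\<in>{a \<in> ?B. int n dvd (\<Sum>i<d. a i * (y i - x i))}. ?w a))"
    unfolding sum.inter_filter [OF fin] sum_distrib_left by (rule sum.swap)
  \<comment> \<open>For \<open>z = y - x\<close> the coefficient vanishes unless \<open>y\<close>
    and \<open>x\<close> are congruent in every coordinate, which for representatives in
    \<open>{0..<n}\<close> means \<open>y = x\<close>.\<close>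
  also have "\<dots> = (\<Sum>y\<in>?B. if y = x then f y * (of_nat n ^ (d - 1) * of_nat (totient n)) else 0)"
    unfolding sum_weights_orthogonal [OF n d] by (intro sum.cong refl) (simp add: y_eq)
  also have "\<dots> = f x * (of_nat n ^ (d - 1) * of_nat (totient n))"
    using x fin by simp
  finally show ?thesis
    using n by simp
qed

end
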